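(* Let $\mathcal{H}$ denote the family of all halfplanes in the plane $\mathbb{R}^2$ and let $\mathcal{D}$ denote the family of all discs in $\mathbb{R}^2$. Then for every integer $n \ge 2$: (i) $s(n,\mathcal{H}) = n-1$ and $s'(n,\mathcal{H}) = \lceil n/2 \rceil$; (ii) $s(n,\mathcal{D}) = s'(n,\mathcal{D}) = \lceil n/2 \rceil$.
   Context: A set $S$ separates two elements $x$ and $y$ if exactly one of $x$ and $y$ is in $S$. A family $\mathcal{F}$ of subsets of a set $X$ is called separating if for any $x,y\in X$ with $x\neq y$ there exists $F\in\mathcal{F}$ that separates $x$ and $y$. Let $\mathcal{A}$ be a family of subsets of the plane and let $X$ be a set of $n$ points in the plane. $s(X,\mathcal{A})$ denotes the size of the smallest subfamily $\mathcal{A}'\subseteq\mathcal{A}$ such that the family $\{A\cap X : A\in\mathcal{A}'\}$ is separating (as a family of subsets of $X$); if there is no such subfamily, $s(X,\mathcal{A})=\infty$. $s(n,\mathcal{A})$ is the maximum of $s(X,\mathcal{A})$ over all $n$-element point sets $X$ in the plane. $s'(n,\mathcal{A})$ is the maximum of $s(X,\mathcal{A})$ over all $n$-element point sets $X$ in the plane in general position, where general position means that no three points of $X$ lie on a line. *)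

theory Defs
  imports "HOL-Analysis.Analysis" "HOL-Library.Extended_Nat"
begin

type_synonym point = "real ^ 2"

definition separates :: "'a set \<Rightarrow> 'a \<Rightarrow> 'a \<Rightarrow> bool" where
  "separates S x y \<longleftrightarrow> (x \<in> S \<and> y \<notin> S) \<or> (x \<notin> S \<and> y \<in> S)"

definition separating :: "'a set \<Rightarrow> 'a set set \<Rightarrow> bool" where
  "separating X \<F> \<longleftrightarrow> (\<forall>x\<in>X. \<forall>y\<in>X. x \<noteq> y \<longrightarrow> (\<exists>F\<in>\<F>. separates F x y))"

text \<open>
  The infimum of the empty set of extended naturals is \<open>\<infinity>\<close>, and a nonempty infimum is attained.
  Infinite subfamilies would only contribute \<open>\<infinity>\<close>, so they can be left out.
\<close>
definition sep_number :: "point set \<Rightarrow> point set set \<Rightarrow> enat" where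
  "sep_number X \<A> =
     Inf {enat (card \<A>') | \<A>'. \<A>' \<subseteq> \<A> \<and> finite \<A>' \<and> separating X ((\<lambda>A. A \<inter> X) ` \<A>')}"

definition general_position :: "point set \<Rightarrow> bool" where
  "general_position X \<longleftrightarrow>
     (\<forall>x\<in>X. \<forall>y\<in>X. \<forall>z\<in>X. x \<noteq> y \<and> x \<noteq> z \<and> y \<noteq> z \<longrightarrow> \<not> collinear {x, y, z})"

text \<open>
  The maxima are written as suprema in \<^typ>\<open>enat\<close>. A positive finite supremum of extended naturals
  is always attained, so an equation with a positive finite number asserts that it is a maximum.
\<close>
definition max_sep :: "nat \<Rightarrow> point set set \<Rightarrow> enat" where
  "max_sep n \<A> = Sup {sep_number X \<A> | X. finite X \<and> card X = n}"

definition max_sep_gen :: "nat \<Rightarrow> point set set \<Rightarrow> enat" where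
  "max_sep_gen n \<A> = Sup {sep_number X \<A> | X. finite X \<and> card X = n \<and> general_position X}"

text \<open>
  Halfplanes and discs may be open or closed. The choice does not affect
  \<^const>\<open>sep_number\<close> on finite point sets, since boundaries can be perturbed.
\<close>
definition halfplanes :: "point set set" where
  "halfplanes = {{x. a \<bullet> x < b} | a b. a \<noteq> 0} \<union> {{x. a \<bullet> x \<le> b} | a b. a \<noteq> 0}"

definition discs :: "point set set" where
  "discs = {ball c r | c r. r > 0} \<union> {cball c r | c r. r > 0}"

end

theory Submission
  imports Defs
begin

text \<open>
  Lower bounds: on the line, a halfplane separates at most one pair of neighbours; on the circle, the
  trace of a halfplane or of a disc is an arc, which separates at most two of the \<open>n\<close> pairs of cyclic
  neighbours.

  Upper bounds for \<open>\<lceil>n/2\<rceil>\<close>: first split \<open>X\<close> into halves \<open>R\<close> and \<open>B\<close>, then insert the points in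
  pairs \<open>r \<in> R\<close>, \<open>b \<in> B\<close>. As the halves are already separated, \<open>r\<close> and \<open>b\<close> each fail to be separated from
  at most one earlier point, \<open>r'\<close> in \<open>R\<close> and \<open>b'\<close> in \<open>B\<close>, and one further set separates both
  \<open>r\<close> from \<open>r'\<close> and \<open>b\<close> from \<open>b'\<close>. For halfplanes this is a line crossing both segments; for discs one uses
  a halfspace crossing both segments after lifting to the paraboloid, where no three points are collinear.
\<close>

section \<open>Separating families\<close>

lemma separates_commute: "separates S x y \<longleftrightarrow> separates S y x"
  unfolding separates_def by blast

lemma ex_separates_commute: "(\<exists>F\<in>\<F>. separates F x y) \<longleftrightarrow> (\<exists>F\<in>\<F>. separates F y x)"
  unfolding separates_def by blast

text \<open>Points of \<open>X\<close> lie in \<open>A\<close> exactly when they lie in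
  \<open>A \<inter> X\<close>, so from here on the sets themselves stand in for their
  traces.\<close>

lemma separating_traces: "separating X ((\<lambda>A. A \<inter> X) ` \<A>) \<longleftrightarrow> separating X \<A>"
  unfolding separating_def by (simp add: separates_def cong: ball_cong)

lemma sep_number_le:
  assumes "\<A>' \<subseteq> \<A>" "finite \<A>'" "separating X \<A>'" "card \<A>' \<le> m"
  shows "sep_number X \<A> \<le> enat m"
proof -
  have "sep_number X \<A> \<le> enat (card \<A>')"
    unfolding sep_number_def separating_traces by (rule Inf_lower) (use assms in blast)
  then show ?thesis
    using assms(4) by (meson enat_ord_simps(1) order_trans)
qed

lemma sep_number_ge:
  assumes "\<And>\<A>'. \<A>' \<subseteq> \<A> \<Longrightarrow> finite \<A>' \<Longrightarrow> separating X \<A>' \<Longrightarrow> m \<le> card \<A>'"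
  shows "enat m \<le> sep_number X \<A>"
  unfolding sep_number_def separating_traces by (rule Inf_greatest) (use assms in auto)

text \<open>Double counting: every pair needs a member of \<open>\<A>\<close> that separates it, and
  one member serves at most \<open>k\<close> pairs. Used with \<open>k = 1\<close> on the line and
  \<open>k = 2\<close> on the circle.\<close>

lemma pairs_separated_count:
  assumes "finite \<A>" "separating X \<A>" "finite I"
    and "\<And>i. i \<in> I \<Longrightarrow> x i \<in> X \<and> y i \<in> X \<and> x i \<noteq> y i"
    and "\<And>A. A \<in> \<A> \<Longrightarrow> card {i\<in>I. separates A (x i) (y i)} \<le> k"
  shows "card I \<le> k * card \<A>"
proof -
  have "I \<subseteq> (\<Union>A\<in>\<A>. {i\<in>I. separates A (x i) (y i)})"
    using assms(2,4) unfolding separating_def by blast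
  then have "card I \<le> card (\<Union>A\<in>\<A>. {i\<in>I. separates A (x i) (y i)})"
    using assms(1,3) by (intro card_mono) auto
  also have "\<dots> \<le> (\<Sum>A\<in>\<A>. card {i\<in>I. separates A (x i) (y i)})"
    using assms(1) by (rule card_UN_le)
  also have "\<dots> \<le> (\<Sum>A\<in>\<A>. k)"
    using assms(5) by (rule sum_mono)
  finally show ?thesis by (simp add: mult.commute)
qed

text \<open>Both \<open>x\<close> and \<open>y\<close> lie in the same members of
  \<open>\<A>\<close> as \<open>z\<close>, hence in the same members as each other.\<close>

lemma unseparated_unique:
  assumes "separating Y \<A>" "x \<in> Y" "y \<in> Y"
    and "\<forall>A\<in>\<A>. \<not> separates A z x" "\<forall>A\<in>\<A>. \<not> separates A z y"
  shows "x = y"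
  using assms unfolding separating_def separates_def by blast

text \<open>\<open>S\<close> alone settles at most one point on each side, and each further pair
  costs one more set. \<open>S\<close> is carried along in the conclusion so that the induction
  never has to treat a point of \<open>R\<close> against a point of \<open>B\<close> again.\<close>

lemma separating_by_pairing:
  assumes S: "S \<in> \<A>" "\<And>r b. r \<in> R \<Longrightarrow> b \<in> B \<Longrightarrow> separates S r b"
    and two: "\<And>x y. x \<in> R \<union> B \<Longrightarrow> y \<in> R \<union> B \<Longrightarrow> x \<noteq> y \<Longrightarrow> \<exists>A\<in>\<A>. separates A x y"
    and four: "\<And>r r' b b'. \<lbrakk>r \<in> R; r' \<in> R; r \<noteq> r'; b \<in> B; b' \<in> B; b \<noteq> b'\<rbrakk>
      \<Longrightarrow> \<exists>A\<in>\<A>. separates A r r' \<and> separates A b b'"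
    and fin: "finite R" "finite B" and card: "card R \<le> Suc k" "card B \<le> Suc k"
  shows "\<exists>\<A>'\<subseteq>\<A>. S \<in> \<A>' \<and> finite \<A>' \<and> card \<A>' \<le> Suc k \<and> separating (R \<union> B) \<A>'"
  using assms
proof (induction k arbitrary: R B)
  case 0
  have "x = y" if "x \<in> R \<and> y \<in> R \<or> x \<in> B \<and> y \<in> B" for x y
    using that 0 by (metis One_nat_def card_le_Suc0_iff_eq)
  then have "separating (R \<union> B) {S}"
    using 0(2) separates_commute unfolding separating_def by (metis Un_iff insertI1)
  then show ?case using 0(1) by (intro exI[of _ "{S}"]) auto
next
  case (Suc k)
  \<comment> \<open>The sides may differ in size, so one of them may already be empty. The chosen
    point is then arbitrary and removing it changes nothing, which is why membership is stated as an
    alternative to emptiness.\<close>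
  define r where "r = (SOME r. r \<in> R)"
  have "R = {} \<or> r \<in> R" unfolding r_def by (metis ex_in_conv someI)
  then have r: "card (R - {r}) \<le> Suc k" "R = {} \<or> r \<in> R"
    using Suc.prems(7) by (auto simp: card_Diff_singleton)
  define b where "b = (SOME b. b \<in> B)"
  have "B = {} \<or> b \<in> B" unfolding b_def by (metis ex_in_conv someI)
  then have b: "card (B - {b}) \<le> Suc k" "B = {} \<or> b \<in> B"
    using Suc.prems(8) by (auto simp: card_Diff_singleton)
  have "\<exists>\<A>'\<subseteq>\<A>. S \<in> \<A>' \<and> finite \<A>' \<and> card \<A>' \<le> Suc k
    \<and> separating ((R - {r}) \<union> (B - {b})) \<A>'"
    by (rule Suc.IH) (use Suc.prems(1-6) r b in \<open>auto; fail\<close>)+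
  then obtain \<A>' where A': "\<A>' \<subseteq> \<A>" "S \<in> \<A>'" "finite \<A>'" "card \<A>' \<le> Suc k"
    and sep: "separating ((R - {r}) \<union> (B - {b})) \<A>'" by blast
  define P where "P = {r' \<in> R - {r}. \<forall>A\<in>\<A>'. \<not> separates A r r'}"
  define Q where "Q = {b' \<in> B - {b}. \<forall>A\<in>\<A>'. \<not> separates A b b'}"
  have P1: "x = y" if "x \<in> P" "y \<in> P" for x y
    using that unseparated_unique[OF sep] unfolding P_def by blast
  have Q1: "x = y" if "x \<in> Q" "y \<in> Q" for x y
    using that unseparated_unique[OF sep] unfolding Q_def by blast
  \<comment> \<open>\<open>P\<close> and \<open>Q\<close> have at most one element each. If both are
    inhabited, \<open>four\<close> supplies the set; if only one is, \<open>two\<close> does; if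
    neither is, any member of \<open>\<A>\<close> will do.\<close>
  have "\<exists>A\<in>\<A>. (\<forall>r'\<in>P. separates A r r') \<and> (\<forall>b'\<in>Q. separates A b b')"
  proof (cases "P = {}")
    case True
    show ?thesis
    proof (cases "Q = {}")
      case True
      then show ?thesis using \<open>P = {}\<close> Suc.prems(1) by blast
    next
      case False
      then obtain b' where b': "b' \<in> Q" by blast
      then have "\<exists>A\<in>\<A>. separates A b b'"
        using Suc.prems(3)[of b b'] b(2) unfolding Q_def by blast
      then show ?thesis using \<open>P = {}\<close> Q1 b' by blast
    qed
  next
    case False
    then obtain r' where r': "r' \<in> P" by blast
    show ?thesis
    proof (cases "Q = {}")
      case True
      have "\<exists>A\<in>\<A>. separates A r r'"
        using Suc.prems(3)[of r r'] r(2) r' unfolding P_def by blast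
      then show ?thesis using \<open>Q = {}\<close> P1 r' by blast
    next
      case False
      then obtain b' where b': "b' \<in> Q" by blast
      have "\<exists>A\<in>\<A>. separates A r r' \<and> separates A b b'"
        using Suc.prems(4)[of r r' b b'] r(2) b(2) r' b' unfolding P_def Q_def by blast
      then show ?thesis using P1 Q1 r' b' by blast
    qed
  qed
  then obtain A where A: "A \<in> \<A>" "\<And>r'. r' \<in> P \<Longrightarrow> separates A r r'"
    "\<And>b'. b' \<in> Q \<Longrightarrow> separates A b b'" by blast
  have r_sep: "\<exists>F\<in>insert A \<A>'. separates F r x" if "x \<in> R" "x \<noteq> r" for x
    using that A(2)[of x] unfolding P_def by blast
  have b_sep: "\<exists>F\<in>insert A \<A>'. separates F b x" if "x \<in> B" "x \<noteq> b" for x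
    using that A(3)[of x] unfolding Q_def by blast
  have "separating (R \<union> B) (insert A \<A>')"
    unfolding separating_def
  proof (intro ballI impI)
    fix x y assume xy: "x \<in> R \<union> B" "y \<in> R \<union> B" "x \<noteq> y"
    consider "x \<in> R" "y \<in> B" | "x \<in> B" "y \<in> R" | "x \<in> R" "y \<in> R" | "x \<in> B" "y \<in> B"
      using xy by blast
    then show "\<exists>F\<in>insert A \<A>'. separates F x y"
    proof cases
      case 1
      then show ?thesis using Suc.prems(2) A'(2) by blast
    next
      case 2
      then show ?thesis using Suc.prems(2)[of y x] A'(2) separates_commute[of S x y] by blast
    next
      case 3
      then consider "x = r" | "y = r" | "x \<in> R - {r}" "y \<in> R - {r}" by blast
      then show ?thesis
      proof cases
        case 1
        then show ?thesis using r_sep[of y] \<open>y \<in> R\<close> xy(3) by simp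
      next
        case 2
        then show ?thesis
          using r_sep[of x] \<open>x \<in> R\<close> xy(3) ex_separates_commute[of "insert A \<A>'" x r] by simp
      next
        case 3
        then show ?thesis using sep xy(3) unfolding separating_def by blast
      qed
    next
      case 4
      then consider "x = b" | "y = b" | "x \<in> B - {b}" "y \<in> B - {b}" by blast
      then show ?thesis
      proof cases
        case 1
        then show ?thesis using b_sep[of y] \<open>y \<in> B\<close> xy(3) by simp
      next
        case 2
        then show ?thesis
          using b_sep[of x] \<open>x \<in> B\<close> xy(3) ex_separates_commute[of "insert A \<A>'" x b] by simp
      next
        case 3
        then show ?thesis using sep xy(3) unfolding separating_def by blast
      qed
    qed
  qed
  moreover have "card (insert A \<A>') \<le> Suc (Suc k)"
    using A'(3,4) by (simp add: card_insert_if)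
  ultimately show ?case
    using A' A(1) by (intro exI[of _ "insert A \<A>'"]) auto
qed

section \<open>Halfspaces crossing two segments\<close>

lemma separates_halfspace:
  "separates {x. a \<bullet> x < c} u v \<longleftrightarrow> a \<bullet> u < c \<and> c \<le> a \<bullet> v \<or> a \<bullet> v < c \<and> c \<le> a \<bullet> u"
  unfolding separates_def by auto

lemma collinear_iff_scale:
  fixes x y z :: "'a::real_inner"
  shows "collinear {x, y, z} \<longleftrightarrow> x = y \<or> (\<exists>k. z - y = k *\<^sub>R (x - y))"
proof -
  have "collinear {x, y, z} \<longleftrightarrow> collinear {0, x - y, z - y}"
    by (rule collinear_3) simp
  also have "\<dots> \<longleftrightarrow> x = y \<or> (\<exists>k. z - y = k *\<^sub>R (x - y))"
    unfolding collinear_lemma by (auto intro: exI[of _ 0])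
  finally show ?thesis .
qed

text \<open>If the points at 1/3 and at 2/3 of the way from \<open>v\<close> to \<open>v'\<close>
  both lay on the line through \<open>u\<close> and \<open>u'\<close>, so would \<open>v\<close>,
  which is twice the first minus the second.\<close>

lemma open_segment_off_line:
  fixes u u' v v' :: "'a::real_inner"
  assumes "\<not> collinear {u, u', v}"
  obtains t where "0 < t" "t < (1::real)" "\<And>k. v + t *\<^sub>R (v' - v) - u \<noteq> k *\<^sub>R (u' - u)"
proof -
  have "\<exists>t\<in>{1/3, 2/3}. \<forall>k. v + t *\<^sub>R (v' - v) - u \<noteq> k *\<^sub>R (u' - u)"
  proof (rule ccontr)
    assume "\<not> ?thesis"
    then obtain k l where kl: "v + (1/3) *\<^sub>R (v' - v) - u = k *\<^sub>R (u' - u)"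
      "v + (2/3) *\<^sub>R (v' - v) - u = l *\<^sub>R (u' - u)" by auto
    have "v - u = 2 *\<^sub>R (v + (1/3) *\<^sub>R (v' - v) - u) - (v + (2/3) *\<^sub>R (v' - v) - u)"
      by (simp add: algebra_simps scaleR_2)
    also have "\<dots> = (2 * k - l) *\<^sub>R (u' - u)"
      unfolding kl by (simp add: algebra_simps)
    finally have "collinear {u', u, v}" unfolding collinear_iff_scale by blast
    then show False using assms by (simp add: insert_commute)
  qed
  then obtain t where "t \<in> {1/3, 2/3}" "\<And>k. v + t *\<^sub>R (v' - v) - u \<noteq> k *\<^sub>R (u' - u)"
    by blast
  then show ?thesis using that[of t] by auto
qed

text \<open>Take \<open>p\<close> inside the first segment and \<open>q\<close> inside the second,
  each off the line carrying the other. A hyperplane through \<open>p\<close> and \<open>q\<close>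
  that is parallel to neither segment crosses both in inner points. Its normal is built from
  projections, so the argument covers the plane and the space of the lifted points alike.\<close>

lemma halfspace_separates_two_pairs:
  fixes u u' v v' :: "'a::real_inner"
  assumes "\<not> collinear {u, u', v}" "\<not> collinear {v, v', u}"
  obtains a c where "separates {x. a \<bullet> x < c} u u'" "separates {x. a \<bullet> x < c} v v'"
proof -
  obtain t where t: "0 < t" "t < 1" "\<And>k. v + t *\<^sub>R (v' - v) - u \<noteq> k *\<^sub>R (u' - u)"
    using open_segment_off_line[OF assms(1)] by metis
  obtain s where s: "0 < s" "s < 1" "\<And>k. u + s *\<^sub>R (u' - u) - v \<noteq> k *\<^sub>R (v' - v)"
    using open_segment_off_line[OF assms(2)] by metis
  define d e where "d = u' - u" and "e = v' - v"
  define p q where "p = u + s *\<^sub>R d" and "q = v + t *\<^sub>R e"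
  define w where "w = q - p"
  \<comment> \<open>If \<open>d\<close> were a multiple of \<open>w\<close>, then
    \<open>q = p + w\<close> would lie on the line through \<open>u\<close> and
    \<open>u'\<close>.\<close>
  have d: "d \<noteq> k *\<^sub>R w" for k
  proof
    assume k: "d = k *\<^sub>R w"
    have "d \<noteq> 0" using assms(1) by (auto simp: d_def)
    with k have "w = (1/k) *\<^sub>R d" by auto
    then have "q - u = (s + 1/k) *\<^sub>R d"
      unfolding w_def p_def by (simp add: algebra_simps)
    then show False using t(3) unfolding q_def d_def e_def by blast
  qed
  have e: "e \<noteq> k *\<^sub>R w" for k
  proof
    assume k: "e = k *\<^sub>R w"
    have "e \<noteq> 0" using assms(2) by (auto simp: e_def)
    with k have "w = (1/k) *\<^sub>R e" by auto
    then have "p - v = (t - 1/k) *\<^sub>R e"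
      unfolding w_def q_def by (simp add: algebra_simps)
    then show False using s(3) unfolding p_def d_def e_def by blast
  qed
  have w: "w \<bullet> w \<noteq> 0"
  proof
    assume "w \<bullet> w = 0"
    then have "q - u = s *\<^sub>R d" by (simp add: w_def p_def)
    then show False using t(3) unfolding q_def d_def e_def by blast
  qed
  \<comment> \<open>The components of \<open>d\<close> and \<open>e\<close> orthogonal to
    \<open>w\<close>: a normal orthogonal to \<open>w\<close> cannot tell \<open>d\<close> from
    \<open>f\<close> or \<open>e\<close> from \<open>g\<close>.\<close>
  define f g where "f = d - (d \<bullet> w / (w \<bullet> w)) *\<^sub>R w" and "g = e - (e \<bullet> w / (w \<bullet> w)) *\<^sub>R w"
  have fw: "f \<bullet> w = 0" and gw: "g \<bullet> w = 0"
    using w by (simp_all add: f_def g_def inner_diff_left)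
  have fd: "y \<bullet> d = y \<bullet> f" and ge: "y \<bullet> e = y \<bullet> g" if "y \<bullet> w = 0" for y
    using that by (simp_all add: f_def g_def inner_diff_right)
  have f: "f \<bullet> f > 0" and g: "g \<bullet> g > 0"
    using d e by (auto simp: f_def g_def)
  \<comment> \<open>The sign keeps the cross terms from cancelling the squares.\<close>
  define a where "a = (if f \<bullet> g \<ge> 0 then f + g else f - g)"
  have aw: "a \<bullet> w = 0"
    using fw gw by (simp add: a_def inner_add_left inner_diff_left)
  have "a \<bullet> f \<noteq> 0 \<and> a \<bullet> g \<noteq> 0"
  proof (cases "f \<bullet> g \<ge> 0")
    case True
    then have "a \<bullet> f = f \<bullet> f + f \<bullet> g" "a \<bullet> g = f \<bullet> g + g \<bullet> g"
      by (simp_all add: a_def inner_add_left inner_commute[of g f])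
    then show ?thesis using f g True by (intro conjI) linarith+
  next
    case False
    then have "a \<bullet> f = f \<bullet> f - f \<bullet> g" "a \<bullet> g = f \<bullet> g - g \<bullet> g"
      by (simp_all add: a_def inner_diff_left inner_commute[of g f])
    then show ?thesis using f g False by (intro conjI) linarith+
  qed
  then have ad: "a \<bullet> d \<noteq> 0" and ae: "a \<bullet> e \<noteq> 0"
    using fd[OF aw] ge[OF aw] by simp_all
  \<comment> \<open>The functional is not constant along the segment, so its value at an inner point
    lies strictly between its values at the ends.\<close>
  have cross: "separates {x. a \<bullet> x < c} z (z + y)"
    if "a \<bullet> (z + m *\<^sub>R y) = c" "0 < m" "m < 1" "a \<bullet> y \<noteq> 0" for z y m c
  proof -
    define h where "h = m * (a \<bullet> y)"
    have c: "c = a \<bullet> z + h"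
      using that(1) by (simp add: inner_add_right h_def)
    have "0 < h \<and> h < a \<bullet> y \<or> h < 0 \<and> a \<bullet> y < h"
      using that(2-4) mult_strict_right_mono[of m 1 "a \<bullet> y"]
        mult_strict_right_mono_neg[of m 1 "a \<bullet> y"]
      by (cases "a \<bullet> y > 0") (auto simp: mult_pos_neg h_def)
    then show ?thesis
      unfolding separates_halfspace c by (auto simp: inner_add_right)
  qed
  have "a \<bullet> q = a \<bullet> p"
    using aw by (simp add: w_def inner_diff_right)
  then have "separates {x. a \<bullet> x < a \<bullet> p} u (u + d)" "separates {x. a \<bullet> x < a \<bullet> p} v (v + e)"
    using cross[of u s d] cross[of v t e] s(1,2) t(1,2) ad ae unfolding p_def q_def by auto
  then show ?thesis
    using that unfolding d_def e_def by simp
qed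

section \<open>Halving a finite point set\<close>

lemma ex_inner_inj_on:
  fixes X :: "'a::euclidean_space set"
  assumes "finite X"
  obtains a where "a \<noteq> 0" "inj_on (\<lambda>x. a \<bullet> x) X"
proof -
  define D where "D = {x - y | x y. x \<in> X \<and> y \<in> X \<and> x \<noteq> y}"
  have "finite D"
    using finite_subset[of D "(\<lambda>(x, y). x - y) ` (X \<times> X)"] assms unfolding D_def by auto
  \<comment> \<open>A direction that identifies two points of \<open>X\<close> is orthogonal to
    their difference. These finitely many hyperplanes together with 0 form a null set, so some
    direction is left.\<close>
  then have "negligible (\<Union>d\<in>D. {a. d \<bullet> a = 0})"
    by (intro negligible_Union) (auto simp: D_def intro!: negligible_hyperplane)
  then have "negligible (insert 0 (\<Union>d\<in>D. {a. d \<bullet> a = 0}))" by simp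
  then obtain a where "a \<notin> insert 0 (\<Union>d\<in>D. {a. d \<bullet> a = 0})"
    using non_negligible_UNIV by (metis UNIV_eq_I)
  then have a: "a \<noteq> 0" "\<And>d. d \<in> D \<Longrightarrow> d \<bullet> a \<noteq> 0" by auto
  have "inj_on (\<lambda>x. a \<bullet> x) X"
  proof (rule inj_onI, rule ccontr)
    fix x y assume xy: "x \<in> X" "y \<in> X" "a \<bullet> x = a \<bullet> y" "x \<noteq> y"
    then have "x - y \<in> D" unfolding D_def by blast
    moreover have "(x - y) \<bullet> a = 0"
      using xy(3) by (simp add: inner_diff_right inner_commute[of _ a])
    ultimately show False using a(2) by blast
  qed
  then show ?thesis using that a(1) by blast
qed

lemma ex_threshold:
  fixes S :: "real set"
  assumes "finite S" "m \<le> card S"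
  shows "\<exists>c. card {s\<in>S. s < c} = m"
  using assms
proof (induction S arbitrary: m rule: finite_linorder_max_induct)
  case empty
  then show ?case by simp
next
  case (insert b S)
  then have b: "b \<notin> S" by auto
  show ?case
  proof (cases "m \<le> card S")
    case True
    then obtain c where "card {s\<in>S. s < c} = m" using insert.IH by blast
    \<comment> \<open>Capping the threshold at \<open>b\<close> excludes the new maximum and loses
      no element of \<open>S\<close>.\<close>
    moreover have "{s\<in>insert b S. s < min c b} = {s\<in>S. s < c}" using insert.hyps by auto
    ultimately show ?thesis by metis
  next
    case False
    then have "m = card (insert b S)" using insert b by simp
    moreover have "{s\<in>insert b S. s < b + 1} = insert b S" using insert.hyps by force
    ultimately show ?thesis by metis
  qed
qed

lemma ex_halving_halfspace:
  fixes X :: "'a::euclidean_space set"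
  assumes "finite X" "m \<le> card X"
  obtains a c where "a \<noteq> 0" "card {x\<in>X. a \<bullet> x < c} = m"
proof -
  obtain a where a: "a \<noteq> 0" "inj_on (\<lambda>x. a \<bullet> x) X" using ex_inner_inj_on assms(1) by metis
  then have "m \<le> card ((\<lambda>x. a \<bullet> x) ` X)" using assms by (simp add: card_image)
  then obtain c where c: "card {s \<in> (\<lambda>x. a \<bullet> x) ` X. s < c} = m"
    using ex_threshold assms(1) by blast
  have "{s \<in> (\<lambda>x. a \<bullet> x) ` X. s < c} = (\<lambda>x. a \<bullet> x) ` {x\<in>X. a \<bullet> x < c}" by auto
  then have "card {x\<in>X. a \<bullet> x < c} = m"
    using c a(2) by (metis (no_types, lifting) card_image inj_on_subset mem_Collect_eq subsetI)
  then show ?thesis using that a(1) by blast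
qed

text \<open>The common source of the upper bounds for halfplanes and discs. \<open>halving\<close>
  asks only for separation, not for equal traces, since a disc may have to stand for the complement
  of a halfspace. It yields the initial split as well as the sets for single pairs.\<close>

lemma sep_number_le_half:
  fixes X :: "point set"
  assumes "finite X" "X \<noteq> {}"
    and halving: "\<And>a c. a \<noteq> 0 \<Longrightarrow> \<exists>A\<in>\<A>. \<forall>x\<in>X. \<forall>y\<in>X.
      separates {x. a \<bullet> x < c} x y \<longrightarrow> separates A x y"
    and four: "\<And>r r' b b'. \<lbrakk>r \<in> X; r' \<in> X; b \<in> X; b' \<in> X; distinct [r, r', b, b']\<rbrakk>
      \<Longrightarrow> \<exists>A\<in>\<A>. separates A r r' \<and> separates A b b'"
  shows "sep_number X \<A> \<le> enat ((card X + 1) div 2)"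
proof -
  have "(card X + 1) div 2 \<le> card X" by linarith
  then obtain a c where a: "a \<noteq> 0" and c: "card {x\<in>X. a \<bullet> x < c} = (card X + 1) div 2"
    by (rule ex_halving_halfspace[OF assms(1)])
  define R B where "R = {x\<in>X. a \<bullet> x < c}" and "B = {x\<in>X. \<not> a \<bullet> x < c}"
  obtain S where S: "S \<in> \<A>" "\<And>x y. x \<in> X \<Longrightarrow> y \<in> X \<Longrightarrow>
      separates {x. a \<bullet> x < c} x y \<Longrightarrow> separates S x y"
    using halving[OF a, of c] by blast
  have RB: "R \<union> B = X" "R \<inter> B = {}" "finite R" "finite B"
    using assms(1) by (auto simp: R_def B_def)
  then have cards: "card R + card B = card X" by (metis card_Un_disjoint)
  \<comment> \<open>Nonemptiness makes the bound positive, hence of the form \<open>Suc k\<close>;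
    \<open>R\<close> receives the larger half.\<close>
  have "card X > 0" using assms by (simp add: card_gt_0_iff)
  then obtain k where k: "(card X + 1) div 2 = Suc k"
    by (cases "(card X + 1) div 2") auto
  have R: "card R = Suc k" using c k by (simp add: R_def)
  have B: "card B \<le> Suc k" using cards R k by linarith
  have "\<exists>\<A>'\<subseteq>\<A>. S \<in> \<A>' \<and> finite \<A>' \<and> card \<A>' \<le> Suc k \<and> separating (R \<union> B) \<A>'"
  proof (rule separating_by_pairing)
    show "separates S r b" if "r \<in> R" "b \<in> B" for r b
      using that S(2)[of r b] by (auto simp: R_def B_def separates_def)
    show "\<exists>A\<in>\<A>. separates A x y" if "x \<in> R \<union> B" "y \<in> R \<union> B" "x \<noteq> y" for x y
    proof -
      \<comment> \<open>The halfspace with normal \<open>y - x\<close> and boundary through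
        \<open>y\<close> contains \<open>x\<close> but not \<open>y\<close>.\<close>
      have "0 < (y - x) \<bullet> y - (y - x) \<bullet> x"
        unfolding inner_diff_right[symmetric] using that(3) by simp
      then have "separates {z. (y - x) \<bullet> z < (y - x) \<bullet> y} x y"
        unfolding separates_halfspace by linarith
      then show ?thesis
        using halving[of "y - x" "(y - x) \<bullet> y"] that RB(1) by auto
    qed
    show "\<exists>A\<in>\<A>. separates A r r' \<and> separates A b b'"
      if "r \<in> R" "r' \<in> R" "r \<noteq> r'" "b \<in> B" "b' \<in> B" "b \<noteq> b'" for r r' b b'
      by (rule four) (use that RB in auto)
  qed (use S(1) RB R B in auto)
  then obtain \<A>' where "\<A>' \<subseteq> \<A>" "finite \<A>'" "separating X \<A>'" "card \<A>' \<le> Suc k"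
    unfolding RB(1) by blast
  then show ?thesis
    unfolding k by (rule sep_number_le)
qed

section \<open>Halfplanes\<close>

lemma halfplanes_le_half:
  assumes "finite X" "X \<noteq> {}" "general_position X"
  shows "sep_number X halfplanes \<le> enat ((card X + 1) div 2)"
proof (rule sep_number_le_half[OF assms(1,2)])
  fix a :: point and c assume "a \<noteq> 0"
  then have "{x. a \<bullet> x < c} \<in> halfplanes" unfolding halfplanes_def by blast
  then show "\<exists>A\<in>halfplanes. \<forall>x\<in>X. \<forall>y\<in>X. separates {x. a \<bullet> x < c} x y \<longrightarrow> separates A x y"
    by blast
next
  fix r r' b b' assume "r \<in> X" "r' \<in> X" "b \<in> X" "b' \<in> X" "distinct [r, r', b, b']"
  then have "\<not> collinear {r, r', b}" "\<not> collinear {b, b', r}"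
    using assms(3) unfolding general_position_def by auto
  then obtain a c where ac: "separates {x. a \<bullet> x < c} r r'" "separates {x. a \<bullet> x < c} b b'"
    using halfspace_separates_two_pairs by metis
  then have "a \<noteq> 0" by (auto simp: separates_halfspace)
  then show "\<exists>A\<in>halfplanes. separates A r r' \<and> separates A b b'"
    using ac unfolding halfplanes_def by blast
qed

text \<open>Sweep in a direction that orders \<open>X\<close> strictly and cut just behind each
  point except the last one, \<open>z\<close>. Of two points, the cut at the earlier one separates
  them.\<close>

lemma halfplanes_le_pred:
  assumes "finite X"
  shows "sep_number X halfplanes \<le> enat (card X - 1)"
proof (cases "X = {}")
  case True
  then show ?thesis
    by (intro sep_number_le[of "{}"]) (auto simp: separating_def)
next
  case False
  obtain a where a: "a \<noteq> 0" "inj_on (\<lambda>x. a \<bullet> x) X" using ex_inner_inj_on assms by metis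
  obtain z where z: "z \<in> X" "\<And>x. x \<in> X \<Longrightarrow> a \<bullet> x \<le> a \<bullet> z"
    using obtains_MAX[OF assms False, of "\<lambda>x. a \<bullet> x"] Max_ge[OF finite_imageI[OF assms]]
    by (metis imageI)
  define \<A> where "\<A> = (\<lambda>x. {y. a \<bullet> y \<le> a \<bullet> x}) ` (X - {z})"
  have less: "\<exists>A\<in>\<A>. separates A x y" if "x \<in> X" "y \<in> X" "a \<bullet> x < a \<bullet> y" for x y
  proof -
    have "x \<noteq> z" using that z(2)[of y] by auto
    moreover have "separates {y. a \<bullet> y \<le> a \<bullet> x} x y"
      using that by (simp add: separates_def)
    ultimately show ?thesis using that(1) unfolding \<A>_def by blast
  qed
  have "separating X \<A>"
    unfolding separating_def
  proof (intro ballI impI)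
    fix x y assume xy: "x \<in> X" "y \<in> X" "x \<noteq> y"
    then have "a \<bullet> x < a \<bullet> y \<or> a \<bullet> y < a \<bullet> x"
      using a(2) unfolding inj_on_def by (metis linorder_neqE_linordered_idom)
    then show "\<exists>A\<in>\<A>. separates A x y"
      using less xy separates_commute by metis
  qed
  moreover have "\<A> \<subseteq> halfplanes"
    using a(1) unfolding \<A>_def halfplanes_def by blast
  moreover have "card \<A> \<le> card X - 1"
    using card_image_le[of "X - {z}" "\<lambda>x. {y. a \<bullet> y \<le> a \<bullet> x}"] assms z(1)
    by (simp add: \<A>_def card_Diff_singleton)
  ultimately show ?thesis
    using assms by (intro sep_number_le[of \<A>]) (auto simp: \<A>_def)
qed

text \<open>On \<open>n\<close> equally spaced points of a line a linear functional is monotone, so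
  membership in a halfplane changes at most once along the \<open>n - 1\<close> neighbouring
  pairs.\<close>

lemma halfplanes_ge_pred:
  "\<exists>X. finite X \<and> card X = n \<and> enat (n - 1) \<le> sep_number X halfplanes"
proof -
  define x :: "nat \<Rightarrow> point" where "x i = vector [real i, 0]" for i
  have x1: "x i $ 1 = real i" and x2: "x i $ 2 = 0" for i by (simp_all add: x_def)
  have inj: "inj x" using x1 by (metis injI of_nat_eq_iff)
  define X where "X = x ` {..<n}"
  have "finite X" "card X = n"
    using inj by (auto simp: X_def card_image inj_on_subset)
  moreover have "enat (n - 1) \<le> sep_number X halfplanes"
  proof (rule sep_number_ge)
    fix \<A> assume \<A>: "\<A> \<subseteq> halfplanes" "finite \<A>" "separating X \<A>"
    have "card {..<n-1} \<le> 1 * card \<A>"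
    proof (rule pairs_separated_count[where x = x and y = "\<lambda>i. x (Suc i)", OF \<A>(2,3)])
      fix A assume "A \<in> \<A>"
      then have "A \<in> halfplanes" using \<A>(1) by blast
      then obtain a c where A: "A = {x. a \<bullet> x < c} \<or> A = {x. a \<bullet> x \<le> c}"
        unfolding halfplanes_def by blast
      define v where "v i = a \<bullet> x i" for i
      have v: "v i = a $ 1 * real i" for i
        by (simp add: v_def inner_vec_def sum_2 x1 x2)
      have mono: "v i \<le> v j" if "i \<le> j" "a $ 1 \<ge> 0" for i j
        unfolding v using that by (intro mult_left_mono) auto
      have anti: "v j \<le> v i" if "i \<le> j" "a $ 1 \<le> 0" for i j
        unfolding v using that by (intro mult_left_mono_neg) auto
      have mem: "(\<forall>i. x i \<in> A \<longleftrightarrow> v i < c) \<or> (\<forall>i. x i \<in> A \<longleftrightarrow> v i \<le> c)"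
        using A by (auto simp: v_def)
      have no: False if "i < j" "separates A (x i) (x (Suc i))" "separates A (x j) (x (Suc j))" for i j
      proof -
        have ij: "i \<le> Suc i" "Suc i \<le> j" "j \<le> Suc j" using that by auto
        show False
        proof (cases "a $ 1 \<ge> 0")
          case True
          from ij[THEN mono, OF True] mem show False
            using that(2,3) unfolding separates_def by force
        next
          case False
          then have "a $ 1 \<le> 0" by simp
          from ij[THEN anti, OF this] mem show False
            using that(2,3) unfolding separates_def by force
        qed
      qed
      have "i = j" if "separates A (x i) (x (Suc i))" "separates A (x j) (x (Suc j))" for i j
        using no that by (meson linorder_neqE_nat)
      then show "card {i \<in> {..<n-1}. separates A (x i) (x (Suc i))} \<le> 1"
        by (intro card_le_Suc0_iff_eq[THEN iffD2, unfolded One_nat_def[symmetric]]) auto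
    qed (auto simp: X_def dest: injD[OF inj])
    then show "n - 1 \<le> card \<A>" by simp
  qed
  ultimately show ?thesis by blast
qed

section \<open>Discs\<close>

text \<open>With \<open>d = x - y\<close> the second equation reduces to \<open>k^2 = k\<close>
  times \<open>d \<bullet> d\<close>: a line meets the graph of the squared norm, or a sphere, in at
  most two points.\<close>

lemma ratio_zero_or_one:
  fixes x y z :: "'a::real_inner"
  assumes "z - y = k *\<^sub>R (x - y)" "z \<bullet> z - y \<bullet> y = k * (x \<bullet> x - y \<bullet> y)"
  shows "x = y \<or> z = y \<or> z = x"
proof -
  define d where "d = x - y"
  have z: "z = y + k *\<^sub>R d" and x: "x = y + d"
    using assms(1) by (auto simp: d_def algebra_simps)
  have "k * (k * (d \<bullet> d)) = k * (d \<bullet> d)"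
    using assms(2) unfolding x z
    by (simp add: inner_add_left inner_add_right inner_commute[of d y] algebra_simps)
  then have "k = 0 \<or> k = 1 \<or> d = 0" by auto
  then show ?thesis using x z by auto
qed

lemma not_collinear_paraboloid:
  fixes x y z :: "'a::real_inner"
  assumes "x \<noteq> y" "x \<noteq> z" "y \<noteq> z"
  shows "\<not> collinear {(x, x \<bullet> x), (y, y \<bullet> y), (z, z \<bullet> z)}"
proof
  assume "collinear {(x, x \<bullet> x), (y, y \<bullet> y), (z, z \<bullet> z)}"
  then obtain k where "(z, z \<bullet> z) - (y, y \<bullet> y) = k *\<^sub>R ((x, x \<bullet> x) - (y, y \<bullet> y))"
    using assms unfolding collinear_iff_scale by blast
  then have "z - y = k *\<^sub>R (x - y)" "z \<bullet> z - y \<bullet> y = k * (x \<bullet> x - y \<bullet> y)" by auto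
  then show False using ratio_zero_or_one assms by blast
qed

lemma not_collinear_sphere:
  fixes x y z :: "'a::real_inner"
  assumes "x \<noteq> y" "x \<noteq> z" "y \<noteq> z" "x \<bullet> x = r" "y \<bullet> y = r" "z \<bullet> z = r"
  shows "\<not> collinear {x, y, z}"
proof
  assume "collinear {x, y, z}"
  then obtain k where "z - y = k *\<^sub>R (x - y)"
    using assms unfolding collinear_iff_scale by blast
  then show False using ratio_zero_or_one[of z y k x] assms by simp
qed

section \<open>From quadratic inequalities to discs\<close>

lemma quadratic_sublevel_is_ball:
  fixes a :: "'a::real_inner"
  assumes "\<alpha> > 0" "\<alpha> * (z \<bullet> z) + a \<bullet> z - c < 0"
  shows "\<exists>q r. r > 0 \<and> {x. \<alpha> * (x \<bullet> x) + a \<bullet> x - c < 0} = ball q r"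
proof -
  \<comment> \<open>Completing the square: \<open>q\<close> is the centre and \<open>\<rho>\<close>
    the squared radius, which the point \<open>z\<close> shows to be positive.\<close>
  define q where "q = (- 1 / (2 * \<alpha>)) *\<^sub>R a"
  define \<rho> where "\<rho> = c / \<alpha> + (a \<bullet> a) / (4 * \<alpha>\<^sup>2)"
  have eq: "\<alpha> * (x \<bullet> x) + a \<bullet> x - c = \<alpha> * ((dist q x)\<^sup>2 - \<rho>)" for x
    using assms(1) unfolding dist_norm power2_norm_eq_inner q_def \<rho>_def
    by (simp add: inner_diff_left inner_diff_right inner_commute[of x a] field_simps power2_eq_square)
  have iff: "\<alpha> * (x \<bullet> x) + a \<bullet> x - c < 0 \<longleftrightarrow> (dist q x)\<^sup>2 < \<rho>" for x
    unfolding eq using assms(1) by (simp add: mult_less_0_iff)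
  have "(dist q z)\<^sup>2 < \<rho>" using assms(2) iff by blast
  then have "\<rho> > 0" using zero_le_power2[of "dist q z"] by linarith
  moreover have "dist q x < sqrt \<rho> \<longleftrightarrow> (dist q x)\<^sup>2 < \<rho>" for x
    using real_sqrt_less_iff[of "(dist q x)\<^sup>2" \<rho>] by simp
  ultimately show ?thesis
    using iff by (intro exI[of _ q] exI[of _ "sqrt \<rho>"]) (auto simp: ball_def)
qed

lemma ball_in_discs: "r > 0 \<Longrightarrow> ball q r \<in> discs"
  unfolding discs_def by (intro UnI1 CollectI exI[of _ q] exI[of _ r]) simp

text \<open>Adding a small \<open>\<delta> * (1 + x \<bullet> x)\<close> keeps the finitely many
  negative values negative, makes the others strictly positive, and can avoid a vanishing leading
  coefficient. The zero set is then a genuine circle that misses \<open>X\<close>, so the open disc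
  inside it serves even when it is the positive side.\<close>

lemma quadratic_separated_by_disc:
  fixes a :: point
  assumes "finite X"
  shows "\<exists>A\<in>discs. \<forall>x\<in>X. \<forall>y\<in>X.
    separates {x. \<alpha> * (x \<bullet> x) + a \<bullet> x < c} x y \<longrightarrow> separates A x y"
proof -
  define f where "f x = \<alpha> * (x \<bullet> x) + a \<bullet> x - c" for x
  have "\<forall>\<^sub>F \<delta> in at_right 0. \<forall>x\<in>{x\<in>X. f x < 0}. f x + \<delta> * (1 + x \<bullet> x) < 0"
  proof (rule eventually_ball_finite)
    show "finite {x\<in>X. f x < 0}" using assms by simp
    show "\<forall>x\<in>{x\<in>X. f x < 0}. \<forall>\<^sub>F \<delta> in at_right 0. f x + \<delta> * (1 + x \<bullet> x) < 0"
    proof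
      fix x assume "x \<in> {x\<in>X. f x < 0}"
      moreover have "((\<lambda>\<delta>. f x + \<delta> * (1 + x \<bullet> x)) \<longlongrightarrow> f x + 0 * (1 + x \<bullet> x)) (at_right 0)"
        by (intro tendsto_intros)
      ultimately show "\<forall>\<^sub>F \<delta> in at_right 0. f x + \<delta> * (1 + x \<bullet> x) < 0"
        by (intro order_tendstoD(2)) auto
    qed
  qed
  moreover have "\<forall>\<^sub>F \<delta> in at_right (0::real). \<delta> > 0"
    by (rule eventually_at_right_less)
  moreover have "\<forall>\<^sub>F \<delta> in at_right (0::real). \<delta> \<noteq> - \<alpha>"
    by (cases "\<alpha> < 0")
      (auto simp: eventually_at_right_field intro: exI[of _ "- \<alpha>"] exI[of _ 1])
  ultimately have "\<forall>\<^sub>F \<delta> in at_right 0. (\<forall>x\<in>{x\<in>X. f x < 0}. f x + \<delta> * (1 + x \<bullet> x) < 0)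
      \<and> \<delta> > 0 \<and> \<delta> \<noteq> - \<alpha>"
    by (intro eventually_conj)
  then obtain \<delta> where \<delta>: "\<And>x. x \<in> X \<Longrightarrow> f x < 0 \<Longrightarrow> f x + \<delta> * (1 + x \<bullet> x) < 0" "\<delta> > 0" "\<delta> \<noteq> - \<alpha>"
    by (metis (mono_tags, lifting) eventually_happens' mem_Collect_eq trivial_limit_at_right_real)
  define g where "g x = (\<alpha> + \<delta>) * (x \<bullet> x) + a \<bullet> x - (c - \<delta>)" for x
  have g: "g x = f x + \<delta> * (1 + x \<bullet> x)" for x
    by (simp add: g_def f_def algebra_simps)
  have neg: "g x < 0" if "x \<in> X" "f x < 0" for x using that \<delta>(1) g by simp
  have pos: "g x > 0" if "f x \<ge> 0" for x
    using that \<delta>(2) by (simp add: g add_nonneg_pos add_pos_nonneg)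
  have sep: "g x < 0 \<and> g y > 0 \<or> g x > 0 \<and> g y < 0"
    if "x \<in> X" "y \<in> X" "separates {x. \<alpha> * (x \<bullet> x) + a \<bullet> x < c} x y" for x y
    using that neg[of x] neg[of y] pos[of x] pos[of y] unfolding separates_def f_def by auto
  show ?thesis
  proof (cases "\<exists>x\<in>X. \<exists>y\<in>X. separates {x. \<alpha> * (x \<bullet> x) + a \<bullet> x < c} x y")
    case False
    \<comment> \<open>No pair needs separating, so any disc will do. The construction in the other
      case needs both signs of \<open>g\<close> to obtain a positive radius.\<close>
    have "ball 0 1 \<in> discs" by (simp add: ball_in_discs)
    then show ?thesis using False by blast
  next
    case True
    then obtain x y where "x \<in> X" "y \<in> X" "separates {x. \<alpha> * (x \<bullet> x) + a \<bullet> x < c} x y"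
      by blast
    from sep[OF this] obtain z z' where z: "g z < 0" "g z' > 0" by blast
    \<comment> \<open>For \<open>\<alpha> + \<delta> < 0\<close> the disc is the complementary set.\<close>
    have "\<exists>A\<in>discs. A = {x. g x < 0} \<or> A = {x. g x > 0}"
    proof (cases "\<alpha> + \<delta> > 0")
      case True
      have "\<exists>q r. r > 0 \<and> {x. g x < 0} = ball q r"
        unfolding g_def by (rule quadratic_sublevel_is_ball[OF True z(1)[unfolded g_def]])
      then obtain q r where "r > 0" "{x. g x < 0} = ball q r" by metis
      then show ?thesis by (intro bexI[of _ "ball q r"]) (simp_all add: ball_in_discs)
    next
      case False
      have g': "g x > 0 \<longleftrightarrow> (- \<alpha> - \<delta>) * (x \<bullet> x) + (- a) \<bullet> x - (\<delta> - c) < 0" for x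
        by (auto simp: g_def algebra_simps)
      have "- \<alpha> - \<delta> > 0" using False \<delta>(3) by linarith
      then have "\<exists>q r. r > 0 \<and> {x. g x > 0} = ball q r"
        unfolding g' by (rule quadratic_sublevel_is_ball[OF _ z(2)[unfolded g']])
      then obtain q r where "r > 0" "{x. g x > 0} = ball q r" by metis
      then show ?thesis by (intro bexI[of _ "ball q r"]) (simp_all add: ball_in_discs)
    qed
    then obtain A where A: "A \<in> discs" "A = {x. g x < 0} \<or> A = {x. g x > 0}" by blast
    have "separates A x y"
      if "x \<in> X" "y \<in> X" "separates {x. \<alpha> * (x \<bullet> x) + a \<bullet> x < c} x y" for x y
      using A(2) sep[OF that] by (auto simp: separates_def)
    then show ?thesis using A(1) by blast
  qed
qed

lemma discs_le_half:
  assumes "finite X" "X \<noteq> {}"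
  shows "sep_number X discs \<le> enat ((card X + 1) div 2)"
proof (rule sep_number_le_half[OF assms])
  fix a :: point and c
  show "\<exists>A\<in>discs. \<forall>x\<in>X. \<forall>y\<in>X. separates {x. a \<bullet> x < c} x y \<longrightarrow> separates A x y"
    using quadratic_separated_by_disc[OF assms(1), of 0 a c] by simp
next
  fix r r' b b' assume X: "r \<in> X" "r' \<in> X" "b \<in> X" "b' \<in> X" and dist: "distinct [r, r', b, b']"
  define l :: "point \<Rightarrow> point \<times> real" where "l x = (x, x \<bullet> x)" for x
  have "\<not> collinear {l r, l r', l b}" "\<not> collinear {l b, l b', l r}"
    using not_collinear_paraboloid[of r r' b] not_collinear_paraboloid[of b b' r] dist
    by (auto simp: l_def)
  then obtain w c where w: "separates {x. w \<bullet> x < c} (l r) (l r')" "separates {x. w \<bullet> x < c} (l b) (l b')"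
    using halfspace_separates_two_pairs by metis
  \<comment> \<open>Pulled back along the lift, the halfspace with normal \<open>w\<close> becomes a
    quadratic inequality with leading coefficient \<open>snd w\<close>.\<close>
  have "separates {x. snd w * (x \<bullet> x) + fst w \<bullet> x < c} x y"
    if "separates {x. w \<bullet> x < c} (l x) (l y)" for x y
    using that by (simp add: separates_def l_def inner_prod_def add.commute)
  then show "\<exists>A\<in>discs. separates A r r' \<and> separates A b b'"
    using quadratic_separated_by_disc[OF assms(1), of "snd w" "fst w" c] w X by blast
qed

section \<open>Points on a circle\<close>

text \<open>For \<open>\<alpha> \<ge> 0\<close> the sublevel set is convex; for negative
  \<open>\<alpha>\<close> the same argument applies to the complement.\<close>

lemma quadratic_sublevel_interval:
  fixes \<alpha> :: real
  assumes "S = {t. \<alpha> * t\<^sup>2 + \<beta> * t < \<gamma>} \<or> S = {t. \<alpha> * t\<^sup>2 + \<beta> * t \<le> \<gamma>}"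
  shows "is_interval S \<or> is_interval (- S)"
proof -
  have mid: "\<alpha> * t\<^sup>2 + \<beta> * t \<le> max (\<alpha> * s\<^sup>2 + \<beta> * s) (\<alpha> * u\<^sup>2 + \<beta> * u)"
    if "s \<le> t" "t \<le> u" "\<alpha> \<ge> 0" for s t u \<alpha> \<beta> :: real
  proof (rule ccontr)
    \<comment> \<open>\<open>\<alpha> * (y + x) + \<beta>\<close> is the slope of the chord, which
      cannot fall from left to right. A value at \<open>t\<close> above both end values would need a
      positive slope followed by a negative one.\<close>
    have diff: "(\<alpha> * y\<^sup>2 + \<beta> * y) - (\<alpha> * x\<^sup>2 + \<beta> * x) = (y - x) * (\<alpha> * (y + x) + \<beta>)" for x y
      by (simp add: algebra_simps power2_eq_square)
    assume "\<not> ?thesis"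
    then have "(t - s) * (\<alpha> * (t + s) + \<beta>) > 0" "(u - t) * (\<alpha> * (u + t) + \<beta>) < 0"
      unfolding diff[symmetric] by linarith+
    then have "\<alpha> * (t + s) + \<beta> > 0" "\<alpha> * (u + t) + \<beta> < 0"
      using that by (auto simp: zero_less_mult_iff mult_less_0_iff)
    moreover have "\<alpha> * (t + s) \<le> \<alpha> * (u + t)" using that by (intro mult_left_mono) auto
    ultimately show False by linarith
  qed
  show ?thesis
  proof (cases "\<alpha> \<ge> 0")
    case True
    have "t \<in> S" if "s \<in> S" "u \<in> S" "s \<le> t" "t \<le> u" for s t u
      using mid[OF that(3,4) True, of \<beta>] that(1,2) assms by (auto simp: max_def split: if_splits)
    then show ?thesis unfolding is_interval_1 by blast
  next
    case False
    have "t \<in> - S" if "s \<in> - S" "u \<in> - S" "s \<le> t" "t \<le> u" for s t u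
      using mid[OF that(3,4), of "- \<alpha>" "- \<beta>"] False that(1,2) assms
      by (auto simp: max_def split: if_splits)
    then show ?thesis unfolding is_interval_1 by blast
  qed
qed

lemma card_cyclic_changes_le:
  assumes conv: "\<And>i j k. \<lbrakk>i \<in> J; k \<in> J; i \<le> j; j \<le> k\<rbrakk> \<Longrightarrow> j \<in> J" and J: "J \<subseteq> {..<n}"
  shows "card {i\<in>{..<n}. (i \<in> J) \<noteq> (Suc i mod n \<in> J)} \<le> 2"
proof (cases "J = {}")
  case False
  have "finite J" using J finite_subset by blast
  define l u where "l = Min J" and "u = Max J"
  have lu: "l \<in> J" "u \<in> J" using False \<open>finite J\<close> by (auto simp: l_def u_def)
  have iff: "i \<in> J \<longleftrightarrow> l \<le> i \<and> i \<le> u" for i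
    using conv[OF lu] Min_le[OF \<open>finite J\<close>] Max_ge[OF \<open>finite J\<close>] by (auto simp: l_def u_def)
  have u: "u < n" using lu J by auto
  \<comment> \<open>The two changes occur when leaving the last index \<open>u\<close> and when
    entering the first index \<open>l\<close>, whose cyclic predecessor is \<open>n - 1\<close> if
    \<open>l = 0\<close>.\<close>
  have "{i\<in>{..<n}. (i \<in> J) \<noteq> (Suc i mod n \<in> J)} \<subseteq> {u, if l = 0 then n - 1 else l - 1}"
    using u by (auto simp: iff mod_Suc split: if_splits)
  then have "card {i\<in>{..<n}. (i \<in> J) \<noteq> (Suc i mod n \<in> J)}
      \<le> card {u, if l = 0 then n - 1 else l - 1}"
    by (intro card_mono) auto
  also have "\<dots> \<le> 2" by (simp add: card_insert_if)
  finally show ?thesis .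
qed simp

text \<open>In the rational parametrization of the unit circle, clearing the denominator
  \<open>1 + t\<^sup>2\<close> turns a linear inequality into a quadratic one in \<open>t\<close>. A
  halfplane therefore cuts out an interval of parameters or the complement of one.\<close>

lemma circle_configuration:
  obtains x :: "nat \<Rightarrow> point" where
    "inj x" "general_position (x ` {..<n})" "\<And>i. x i \<bullet> x i = 1"
    "\<And>A a c. A = {x. a \<bullet> x < c} \<or> A = {x. a \<bullet> x \<le> c} \<Longrightarrow>
      card {i\<in>{..<n}. separates A (x i) (x (Suc i mod n))} \<le> 2"
proof -
  define y :: "real \<Rightarrow> point" where "y t = vector [(1 - t\<^sup>2) / (1 + t\<^sup>2), 2 * t / (1 + t\<^sup>2)]" for t
  define x where "x i = y (real i)" for i :: nat
  have pos: "1 + t\<^sup>2 > 0" for t :: real by (simp add: add_pos_nonneg)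
  then have nz: "1 + t\<^sup>2 \<noteq> 0" for t :: real by (metis less_irrefl)
  have y1: "y t $ 1 = (1 - t\<^sup>2) / (1 + t\<^sup>2)" and y2: "y t $ 2 = 2 * t / (1 + t\<^sup>2)" for t
    by (simp_all add: y_def)
  have unit: "y t \<bullet> y t = 1" for t
  proof -
    have "y t \<bullet> y t = ((1 - t\<^sup>2)\<^sup>2 + (2 * t)\<^sup>2) / (1 + t\<^sup>2)\<^sup>2"
      by (simp add: inner_vec_def sum_2 y1 y2 power_divide add_divide_distrib flip: power2_eq_square)
    also have "(1 - t\<^sup>2)\<^sup>2 + (2 * t)\<^sup>2 = (1 + t\<^sup>2)\<^sup>2"
      by (simp add: power2_eq_square algebra_simps)
    finally show ?thesis using nz[of t] by simp
  qed
  \<comment> \<open>The slope of the line from \<open>(-1, 0)\<close> to \<open>y t\<close> recovers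
    the parameter, which gives injectivity.\<close>
  have slope: "y t $ 2 / (1 + y t $ 1) = t" for t
    using nz[of t] by (simp add: y1 y2 field_simps)
  have inj: "inj x"
    by (rule injI) (metis of_nat_eq_iff slope x_def)
  have gen: "general_position (x ` {..<n})"
    unfolding general_position_def
  proof (intro ballI impI)
    fix p q r assume "p \<in> x ` {..<n}" "q \<in> x ` {..<n}" "r \<in> x ` {..<n}"
      and "p \<noteq> q \<and> p \<noteq> r \<and> q \<noteq> r"
    then show "\<not> collinear {p, q, r}"
      by (intro not_collinear_sphere[where r = 1]) (auto simp: x_def unit)
  qed
  have two: "card {i\<in>{..<n}. separates A (x i) (x (Suc i mod n))} \<le> 2"
    if A: "A = {x. a \<bullet> x < c} \<or> A = {x. a \<bullet> x \<le> c}" for A a c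
  proof -
    have ay: "a \<bullet> y t = ((a $ 1) * (1 - t\<^sup>2) + (a $ 2) * (2 * t)) / (1 + t\<^sup>2)" for t
      by (simp add: inner_vec_def sum_2 y1 y2 add_divide_distrib)
    have "a \<bullet> y t < c \<longleftrightarrow> (- (a $ 1) - c) * t\<^sup>2 + (2 * a $ 2) * t < c - a $ 1"
         "a \<bullet> y t \<le> c \<longleftrightarrow> (- (a $ 1) - c) * t\<^sup>2 + (2 * a $ 2) * t \<le> c - a $ 1" for t
      unfolding ay pos_divide_less_eq[OF pos] pos_divide_le_eq[OF pos] by (auto simp: algebra_simps)
    then have "is_interval {t. y t \<in> A} \<or> is_interval (- {t. y t \<in> A})"
      using A by (intro quadratic_sublevel_interval[of _ "- (a $ 1) - c" "2 * a $ 2" "c - a $ 1"]) auto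
    \<comment> \<open>Passing to the complement does not affect which pairs are separated, so
      \<open>S\<close> may be taken to be the interval.\<close>
    then obtain S where S: "is_interval S" "S = {t. y t \<in> A} \<or> S = - {t. y t \<in> A}" by blast
    define J where "J = {i\<in>{..<n}. real i \<in> S}"
    have "card {i\<in>{..<n}. (i \<in> J) \<noteq> (Suc i mod n \<in> J)} \<le> 2"
    proof (rule card_cyclic_changes_le)
      fix i j k assume "i \<in> J" "k \<in> J" "i \<le> j" "j \<le> k"
      then have "real j \<in> S" "j < n"
        using mem_is_interval_1_I[OF S(1), of "real i" "real k" "real j"] by (auto simp: J_def)
      then show "j \<in> J" by (simp add: J_def)
    qed (auto simp: J_def)
    moreover have "{i\<in>{..<n}. separates A (x i) (x (Suc i mod n))}
        = {i\<in>{..<n}. (i \<in> J) \<noteq> (Suc i mod n \<in> J)}"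
      using S(2) by (auto simp: J_def separates_def x_def)
    ultimately show ?thesis by simp
  qed
  show ?thesis
    by (rule that[OF inj gen _ two]) (simp_all add: x_def unit)
qed

text \<open>Only traces on the unit circle matter, and \<open>trace\<close> says that there the
  members look like halfplanes. Each separates at most two of the \<open>n\<close> cyclic neighbour
  pairs, so \<open>n \<le> 2 * card \<B>\<close> for every separating \<open>\<B>\<close>.\<close>

lemma half_le_max_sep_gen:
  assumes "n \<ge> 2"
    and trace: "\<And>A. A \<in> \<A> \<Longrightarrow> \<exists>a c. {x\<in>A. x \<bullet> x = 1} = {x. x \<bullet> x = 1 \<and> a \<bullet> x < c}
      \<or> {x\<in>A. x \<bullet> x = 1} = {x. x \<bullet> x = 1 \<and> a \<bullet> x \<le> c}"
  shows "enat ((n + 1) div 2) \<le> max_sep_gen n \<A>"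
proof -
  obtain x :: "nat \<Rightarrow> point" where inj: "inj x"
    and gen: "general_position (x ` {..<n})" and unit: "\<And>i. x i \<bullet> x i = 1"
    and two: "\<And>A a c. A = {x. a \<bullet> x < c} \<or> A = {x. a \<bullet> x \<le> c} \<Longrightarrow>
      card {i\<in>{..<n}. separates A (x i) (x (Suc i mod n))} \<le> 2"
    by (rule circle_configuration[where n = n]) blast
  define X where "X = x ` {..<n}"
  have "enat ((n + 1) div 2) \<le> sep_number X \<A>"
  proof (rule sep_number_ge)
    fix \<B> assume \<B>: "\<B> \<subseteq> \<A>" "finite \<B>" "separating X \<B>"
    have "card {..<n} \<le> 2 * card \<B>"
    proof (rule pairs_separated_count[where x = x and y = "\<lambda>i. x (Suc i mod n)", OF \<B>(2,3)])
      fix A assume "A \<in> \<B>"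
      then obtain a c where ac: "{x\<in>A. x \<bullet> x = 1} = {x. x \<bullet> x = 1 \<and> a \<bullet> x < c}
          \<or> {x\<in>A. x \<bullet> x = 1} = {x. x \<bullet> x = 1 \<and> a \<bullet> x \<le> c}"
        using trace \<B>(1) by blast
      then obtain A' where A': "A' = {x. a \<bullet> x < c} \<or> A' = {x. a \<bullet> x \<le> c}"
        and eq: "{x\<in>A. x \<bullet> x = 1} = {x\<in>A'. x \<bullet> x = 1}" by blast
      have "x i \<in> A \<longleftrightarrow> x i \<in> A'" for i using eq unit[of i] by blast
      then show "card {i\<in>{..<n}. separates A (x i) (x (Suc i mod n))} \<le> 2"
        using two[OF A'] by (simp add: separates_def)
    next
      fix i assume "i \<in> {..<n}"
      \<comment> \<open>With a single point the cyclic successor would be the point itself;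
        \<open>n \<ge> 2\<close> excludes this.\<close>
      moreover from this have "i \<noteq> Suc i mod n"
        using assms(1) by (auto simp: mod_Suc split: if_splits)
      ultimately show "x i \<in> X \<and> x (Suc i mod n) \<in> X \<and> x i \<noteq> x (Suc i mod n)"
        using assms(1) inj unfolding X_def by (auto dest: injD)
    qed simp
    then show "(n + 1) div 2 \<le> card \<B>" by simp
  qed
  also have "\<dots> \<le> max_sep_gen n \<A>"
    unfolding max_sep_gen_def
  proof (rule Sup_upper)
    have "finite X" "card X = n"
      using inj by (auto simp: X_def card_image inj_on_subset)
    then show "sep_number X \<A> \<in> {sep_number X \<A> |X. finite X \<and> card X = n \<and> general_position X}"
      using gen unfolding X_def by blast
  qed
  finally show ?thesis .
qed

lemma half_le_max_sep_gen_halfplanes: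
  assumes "n \<ge> 2"
  shows "enat ((n + 1) div 2) \<le> max_sep_gen n halfplanes"
proof (rule half_le_max_sep_gen[OF assms])
  fix A assume "A \<in> halfplanes"
  then obtain a c where "A = {x. a \<bullet> x < c} \<or> A = {x. a \<bullet> x \<le> c}"
    unfolding halfplanes_def by blast
  then show "\<exists>a c. {x\<in>A. x \<bullet> x = 1} = {x. x \<bullet> x = 1 \<and> a \<bullet> x < c}
      \<or> {x\<in>A. x \<bullet> x = 1} = {x. x \<bullet> x = 1 \<and> a \<bullet> x \<le> c}"
    by blast
qed

lemma half_le_max_sep_gen_discs:
  assumes "n \<ge> 2"
  shows "enat ((n + 1) div 2) \<le> max_sep_gen n discs"
proof (rule half_le_max_sep_gen[OF assms])
  fix A assume "A \<in> discs"
  then obtain q r where r: "r > 0" and A: "A = ball q r \<or> A = cball q r"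
    unfolding discs_def by blast
  \<comment> \<open>On the unit circle \<open>x \<bullet> x\<close> is 1, so the squared distance to
    \<open>q\<close> is affine in \<open>x\<close>; \<open>c\<close> collects the constants.\<close>
  define c where "c = r\<^sup>2 - 1 - q \<bullet> q"
  have eq: "(dist q x)\<^sup>2 - r\<^sup>2 = (- 2 *\<^sub>R q) \<bullet> x - c" if "x \<bullet> x = 1" for x
    using that by (simp add: c_def dist_norm power2_norm_eq_inner inner_diff_left
        inner_diff_right inner_commute[of x q])
  have "dist q x < r \<longleftrightarrow> (- 2 *\<^sub>R q) \<bullet> x < c" "dist q x \<le> r \<longleftrightarrow> (- 2 *\<^sub>R q) \<bullet> x \<le> c"
    if "x \<bullet> x = 1" for x
  proof -
    have "dist q x < r \<longleftrightarrow> (dist q x)\<^sup>2 - r\<^sup>2 < 0" "dist q x \<le> r \<longleftrightarrow> (dist q x)\<^sup>2 - r\<^sup>2 \<le> 0"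
      using r by (simp_all add: power_mono_iff flip: not_le)
    then show "dist q x < r \<longleftrightarrow> (- 2 *\<^sub>R q) \<bullet> x < c" "dist q x \<le> r \<longleftrightarrow> (- 2 *\<^sub>R q) \<bullet> x \<le> c"
      unfolding eq[OF that] by auto
  qed
  then show "\<exists>a c. {x\<in>A. x \<bullet> x = 1} = {x. x \<bullet> x = 1 \<and> a \<bullet> x < c}
      \<or> {x\<in>A. x \<bullet> x = 1} = {x. x \<bullet> x = 1 \<and> a \<bullet> x \<le> c}"
    using A by (intro exI[of _ "- 2 *\<^sub>R q"] exI[of _ c]) auto
qed

theorem theorem1:
  fixes n :: nat
  assumes "n \<ge> 2"
  shows "(max_sep n halfplanes = enat (n - 1) \<and>
          max_sep_gen n halfplanes = enat (nat \<lceil>real n / 2\<rceil>)) \<and>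
         (max_sep n discs = enat (nat \<lceil>real n / 2\<rceil>) \<and>
          max_sep_gen n discs = enat (nat \<lceil>real n / 2\<rceil>))"
proof -
  have half: "nat \<lceil>real n / 2\<rceil> = (n + 1) div 2"
    by linarith
  have ne: "X \<noteq> {}" if "card X = n" for X :: "point set" using that assms by auto
  have "max_sep n halfplanes \<le> enat (n - 1)"
    unfolding max_sep_def by (rule Sup_least) (use halfplanes_le_pred in blast)
  moreover have "enat (n - 1) \<le> max_sep n halfplanes"
  proof -
    obtain X where "finite X" "card X = n" "enat (n - 1) \<le> sep_number X halfplanes"
      using halfplanes_ge_pred by blast
    then show ?thesis
      unfolding max_sep_def by (intro Sup_upper2[of "sep_number X halfplanes"]) auto
  qed
  moreover have "max_sep_gen n halfplanes \<le> enat ((n + 1) div 2)"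
    unfolding max_sep_gen_def by (rule Sup_least) (use halfplanes_le_half ne in blast)
  moreover have "max_sep n discs \<le> enat ((n + 1) div 2)"
    unfolding max_sep_def by (rule Sup_least) (use discs_le_half ne in blast)
  \<comment> \<open>This closes the chain for discs: the lower bound holds already in general
    position, the upper bound for all point sets.\<close>
  moreover have "max_sep_gen n discs \<le> max_sep n discs"
    unfolding max_sep_def max_sep_gen_def by (rule Sup_subset_mono) blast
  ultimately show ?thesis
    unfolding half using half_le_max_sep_gen_halfplanes[OF assms] half_le_max_sep_gen_discs[OF assms]
    by (meson antisym order_trans)
qed

end
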